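(* Let $\Theta$ be a substitution schema and $\mathcal{U}$ a finite set of unification equations. If $\mathrm{store}_\Theta(\mathcal{U})\neq\bot$, then $\mathcal{U}$ is unifiable (in the usual syntactic first-order sense).
   Context: Variables are objects $X_i$ with $X$ from a countably infinite set $\mathcal{V}_{sym}$ of variable symbols and $i\in\mathbb{N}$; terms are first-order terms over a signature $\Sigma$ and these variables; $\mathrm{cls}(X_i)=\{X\}$. $\mathrm{shift}_d$ adds $d$ to every variable index in a term. A substitution schema $\Theta$ is given by pairwise distinct symbols $X^1,\dots,X^n$ and terms $t_1,\dots,t_n$, and is the infinite mapping $\{X^i_j\mapsto\mathrm{shift}_j(t_i)\mid 1\le i\le n, j\ge0\}$, with $\mathrm{dom}(\Theta)=\{X^1,\dots,X^n\}$. For a variable $x$ write $x\in\Theta$ if $\mathrm{cls}(x)\subseteq\mathrm{dom}(\Theta)$, and $x\notin\Theta$ otherwise. For a term $t$, $\Theta^t$ is the substitution sending each variable $x$ of $t$ with $x\in\Theta$ to its image under $\Theta$ and fixing all other variables; $\Theta^t(0)=t$ and $\Theta^t(k+1)=s\Theta^s$ with $s=\Theta^t(k)$. $\Theta$-unification. A configuration is a pair $(\mathcal{S},\mathcal{U})$ of sets of equations (store, active set). Starting from $(\emptyset,\mathcal{U})$, the procedure first saturates the active set under: Decomposition (replace $f(r_1,\dots,r_n)\stackrel{?}{=}f(s_1,\dots,s_n)$ by the $r_i\stackrel{?}{=}s_i$); Orient-1 (replace $r\stackrel{?}{=}x$, $x$ a variable, $r$ not a variable, by $x\stackrel{?}{=}r$);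 Orient-2 (for variables, if $y\stackrel{?}{=}x$ is present and $x\stackrel{?}{=}y$ not, add $x\stackrel{?}{=}y$); Transitivity (from $x\stackrel{?}{=}r$, $x\stackrel{?}{=}s$, $x$ a variable, $r\ne s$, add $r\stackrel{?}{=}s$); Reflexive (remove $t\stackrel{?}{=}t$); Clash (an equation between non-variable terms with different heads makes the procedure fail). Then Store is applied as long as possible, moving $y\stackrel{?}{=}r$ ($y$ a variable) from the active set to the store if (1) $y\in\Theta$ and, if $r$ is a variable, $r\in\Theta$; or (2) $y\notin\Theta$ and some $x\stackrel{?}{=}s'$ in the store has $y$ occurring in $s'$, or $r=x$, or $y=x$; or (3) $y\notin\Theta$ and for some variable $z\in\Theta$ occurring in the store and some $k\ge0$, $y$ occurs in $\Theta^z(k)$. Finally syntactic unification is run on store $\cup$ active set and the procedure fails if it fails (clash or occurs check). The resulting configuration is the final configuration $\mathrm{fin}_\Theta(\mathcal{U})$ and its store is $\mathrm{store}_\Theta(\mathcal{U})$; if the procedure fails, $\mathrm{store}_\Theta(\mathcal{U})=\bot$. *)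

theory Defs
  imports
    "HOL-Library.Countable"
    "HOL-Library.Infinite_Typeclass"
begin

type_synonym 'v var = "'v \<times> nat"

datatype ('f, 'v) trm =
    Var "'v var"
  | Fun 'f "('f, 'v) trm list"

text \<open>A signature is a type \<open>'f\<close> of function symbols with an arity function.\<close>

fun wf_trm :: "('f \<Rightarrow> nat) \<Rightarrow> ('f, 'v) trm \<Rightarrow> bool" where
  "wf_trm ar (Var x) \<longleftrightarrow> True"
| "wf_trm ar (Fun f ts) \<longleftrightarrow> length ts = ar f \<and> (\<forall>t \<in> set ts. wf_trm ar t)"

fun is_Var :: "('f, 'v) trm \<Rightarrow> bool" where
  "is_Var (Var x) \<longleftrightarrow> True"
| "is_Var (Fun f ts) \<longleftrightarrow> False"

fun vars :: "('f, 'v) trm \<Rightarrow> 'v var set" where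
  "vars (Var x) = {x}"
| "vars (Fun f ts) = (\<Union>t \<in> set ts. vars t)"

fun subst :: "('f, 'v) trm \<Rightarrow> ('v var \<Rightarrow> ('f, 'v) trm) \<Rightarrow> ('f, 'v) trm" (infixl "\<cdot>" 67) where
  "Var x \<cdot> \<sigma> = \<sigma> x"
| "Fun f ts \<cdot> \<sigma> = Fun f (map (\<lambda>t. t \<cdot> \<sigma>) ts)"

definition is_subst :: "('f \<Rightarrow> nat) \<Rightarrow> ('v var \<Rightarrow> ('f, 'v) trm) \<Rightarrow> bool" where
  "is_subst ar \<sigma> \<longleftrightarrow> finite {x. \<sigma> x \<noteq> Var x} \<and> (\<forall>x. wf_trm ar (\<sigma> x))"

text \<open>An equation is an ordered pair of terms.\<close>

type_synonym ('f, 'v) eqn = "('f, 'v) trm \<times> ('f, 'v) trm"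
type_synonym ('f, 'v) eqns = "('f, 'v) eqn set"

definition eqns_over :: "('f \<Rightarrow> nat) \<Rightarrow> ('f, 'v) eqns \<Rightarrow> bool" where
  "eqns_over ar U \<longleftrightarrow> (\<forall>(r, s) \<in> U. wf_trm ar r \<and> wf_trm ar s)"

definition eqns_vars :: "('f, 'v) eqns \<Rightarrow> 'v var set" where
  "eqns_vars U = (\<Union>(r, s) \<in> U. vars r \<union> vars s)"

definition unifiable :: "('f \<Rightarrow> nat) \<Rightarrow> ('f, 'v) eqns \<Rightarrow> bool" where
  "unifiable ar U \<longleftrightarrow> (\<exists>\<sigma>. is_subst ar \<sigma> \<and> (\<forall>(r, s) \<in> U. r \<cdot> \<sigma> = s \<cdot> \<sigma>))"


subsection \<open>Substitution schemata\<close>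

definition cls :: "'v var \<Rightarrow> 'v set" where
  "cls x = {fst x}"

definition shift :: "nat \<Rightarrow> ('f, 'v) trm \<Rightarrow> ('f, 'v) trm" where
  "shift d t = t \<cdot> (\<lambda>(X, i). Var (X, i + d))"

text \<open>
  The schema with symbols \<open>X\<^sup>1, \<dots>, X\<^sup>n\<close> and terms \<open>t\<^sub>1, \<dots>, t\<^sub>n\<close> is the finite
  map sending \<open>X\<^sup>i\<close> to \<open>t\<^sub>i\<close>.
\<close>

type_synonym ('f, 'v) schema = "'v \<rightharpoonup> ('f, 'v) trm"

definition subst_schema :: "('f \<Rightarrow> nat) \<Rightarrow> ('f, 'v) schema \<Rightarrow> bool" where
  "subst_schema ar \<Theta> \<longleftrightarrow> finite (dom \<Theta>) \<and> (\<forall>t \<in> ran \<Theta>. wf_trm ar t)"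

definition in_schema :: "'v var \<Rightarrow> ('f, 'v) schema \<Rightarrow> bool" where
  "in_schema x \<Theta> \<longleftrightarrow> cls x \<subseteq> dom \<Theta>"

definition schema_image :: "('f, 'v) schema \<Rightarrow> 'v var \<Rightarrow> ('f, 'v) trm" where
  "schema_image \<Theta> x = shift (snd x) (the (\<Theta> (fst x)))"

definition schema_subst :: "('f, 'v) schema \<Rightarrow> ('f, 'v) trm \<Rightarrow> 'v var \<Rightarrow> ('f, 'v) trm" where
  "schema_subst \<Theta> t x =
    (if x \<in> vars t \<and> in_schema x \<Theta> then schema_image \<Theta> x else Var x)"

fun schema_iter :: "('f, 'v) schema \<Rightarrow> ('f, 'v) trm \<Rightarrow> nat \<Rightarrow> ('f, 'v) trm" where
  "schema_iter \<Theta> t 0 = t"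
| "schema_iter \<Theta> t (Suc k) = (let s = schema_iter \<Theta> t k in s \<cdot> schema_subst \<Theta> s)"


subsection \<open>Syntactic unification\<close>

text \<open>
  On well-formed terms, different lengths of the argument lists imply different heads.
\<close>

definition clash :: "('f, 'v) eqns \<Rightarrow> bool" where
  "clash U \<longleftrightarrow> (\<exists>f rs g ss. (Fun f rs, Fun g ss) \<in> U \<and> (f, length rs) \<noteq> (g, length ss))"

definition occurs_check :: "('f, 'v) eqns \<Rightarrow> bool" where
  "occurs_check U \<longleftrightarrow> (\<exists>x t. (Var x, t) \<in> U \<and> t \<noteq> Var x \<and> x \<in> vars t)"

text \<open>The Martelli--Montanari transformation rules.\<close>

inductive synt_step :: "('f, 'v) eqns \<Rightarrow> ('f, 'v) eqns \<Rightarrow> bool" where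
  Delete:
    "(t, t) \<in> E \<Longrightarrow> synt_step E (E - {(t, t)})"
| Decompose:
    "(Fun f rs, Fun f ss) \<in> E \<Longrightarrow> length rs = length ss \<Longrightarrow>
     synt_step E (E - {(Fun f rs, Fun f ss)} \<union> set (zip rs ss))"
| Swap:
    "(r, Var x) \<in> E \<Longrightarrow> \<not> is_Var r \<Longrightarrow>
     synt_step E (E - {(r, Var x)} \<union> {(Var x, r)})"
| Eliminate:
    "(Var x, t) \<in> E \<Longrightarrow> x \<notin> vars t \<Longrightarrow> x \<in> eqns_vars (E - {(Var x, t)}) \<Longrightarrow>
     synt_step E (insert (Var x, t)
       ((\<lambda>(r, s). (r \<cdot> Var(x := t), s \<cdot> Var(x := t))) ` (E - {(Var x, t)})))"

definition synt_unif_fails :: "('f, 'v) eqns \<Rightarrow> bool" where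
  "synt_unif_fails E \<longleftrightarrow> (\<exists>E'. synt_step\<^sup>*\<^sup>* E E' \<and> (clash E' \<or> occurs_check E'))"


subsection \<open>\<open>\<Theta>\<close>-unification\<close>

text \<open>Saturation acts on the active set only.\<close>

inductive basic_step :: "('f, 'v) eqns \<Rightarrow> ('f, 'v) eqns \<Rightarrow> bool" where
  Decomposition:
    "(Fun f rs, Fun f ss) \<in> U \<Longrightarrow> length rs = length ss \<Longrightarrow>
     basic_step U (U - {(Fun f rs, Fun f ss)} \<union> set (zip rs ss))"
| Orient_1:
    "(r, Var x) \<in> U \<Longrightarrow> \<not> is_Var r \<Longrightarrow>
     basic_step U (U - {(r, Var x)} \<union> {(Var x, r)})"
| Orient_2:
    "(Var y, Var x) \<in> U \<Longrightarrow> (Var x, Var y) \<notin> U \<Longrightarrow>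
     basic_step U (insert (Var x, Var y) U)"
| Reflexive:
    "(t, t) \<in> U \<Longrightarrow> basic_step U (U - {(t, t)})"

inductive trans_step :: "('f, 'v) eqns \<Rightarrow> ('f, 'v) eqns \<Rightarrow> bool" where
  Transitivity:
    "(Var x, r) \<in> U \<Longrightarrow> (Var x, s) \<in> U \<Longrightarrow> r \<noteq> s \<Longrightarrow>
     trans_step U (insert (r, s) U)"

definition sat_step :: "('f, 'v) eqns \<Rightarrow> ('f, 'v) eqns \<Rightarrow> bool" where
  "sat_step U V \<longleftrightarrow> basic_step U V \<or> trans_step U V"

text \<open>
  The equation added by Transitivity may be consumed at once by Decomposition or
  Orient-1, after which Transitivity would add it again: from \<open>x = f(y)\<close> and
  \<open>x = f(z)\<close> one obtains \<open>f(y) = f(z)\<close> over and over. Saturation is therefore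
  understood up to such repetitions: a Transitivity step need not be performed if the
  other rules merely lead back to the set it was applied to.
\<close>

definition saturated :: "('f, 'v) eqns \<Rightarrow> bool" where
  "saturated U \<longleftrightarrow>
    \<not> clash U \<and>
    (\<nexists>V. basic_step U V) \<and>
    (\<forall>V. trans_step U V \<longrightarrow> basic_step\<^sup>*\<^sup>* V U)"

text \<open>A configuration consists of the store and the active set.\<close>

type_synonym ('f, 'v) config = "('f, 'v) eqns \<times> ('f, 'v) eqns"

definition storable ::
    "('f, 'v) schema \<Rightarrow> ('f, 'v) eqns \<Rightarrow> 'v var \<Rightarrow> ('f, 'v) trm \<Rightarrow> bool" where
  "storable \<Theta> S y r \<longleftrightarrow>
    (in_schema y \<Theta> \<and> (\<forall>z. r = Var z \<longrightarrow> in_schema z \<Theta>)) \<or>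
    (\<not> in_schema y \<Theta> \<and>
      (\<exists>x s'. (Var x, s') \<in> S \<and> (y \<in> vars s' \<or> r = Var x \<or> y = x))) \<or>
    (\<not> in_schema y \<Theta> \<and>
      (\<exists>z k. in_schema z \<Theta> \<and> z \<in> eqns_vars S \<and> y \<in> vars (schema_iter \<Theta> (Var z) k)))"

inductive store_step :: "('f, 'v) schema \<Rightarrow> ('f, 'v) config \<Rightarrow> ('f, 'v) config \<Rightarrow> bool"
  for \<Theta> where
  Store:
    "(Var y, r) \<in> U \<Longrightarrow> storable \<Theta> S y r \<Longrightarrow>
     store_step \<Theta> (S, U) (insert (Var y, r) S, U - {(Var y, r)})"

text \<open>\<open>None\<close> is the failure value \<open>\<bottom>\<close>.\<close>

inductive theta_outcome ::
    "('f, 'v) schema \<Rightarrow> ('f, 'v) eqns \<Rightarrow> ('f, 'v) config option \<Rightarrow> bool"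
  for \<Theta> U where
  Clash:
    "sat_step\<^sup>*\<^sup>* U V \<Longrightarrow> clash V \<Longrightarrow> theta_outcome \<Theta> U None"
| Synt_fail:
    "sat_step\<^sup>*\<^sup>* U V \<Longrightarrow> saturated V \<Longrightarrow>
     (store_step \<Theta>)\<^sup>*\<^sup>* ({}, V) (S, A) \<Longrightarrow> (\<nexists>C. store_step \<Theta> (S, A) C) \<Longrightarrow>
     synt_unif_fails (S \<union> A) \<Longrightarrow> theta_outcome \<Theta> U None"
| Success:
    "sat_step\<^sup>*\<^sup>* U V \<Longrightarrow> saturated V \<Longrightarrow>
     (store_step \<Theta>)\<^sup>*\<^sup>* ({}, V) (S, A) \<Longrightarrow> (\<nexists>C. store_step \<Theta> (S, A) C) \<Longrightarrow>
     \<not> synt_unif_fails (S \<union> A) \<Longrightarrow> theta_outcome \<Theta> U (Some (S, A))"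

text \<open>
  The order of rule applications is left open, but it does not affect the outcome for
  finite sets of equations, so any outcome can be selected.
\<close>

definition fin :: "('f, 'v) schema \<Rightarrow> ('f, 'v) eqns \<Rightarrow> ('f, 'v) config option" where
  "fin \<Theta> U = (SOME C. theta_outcome \<Theta> U C)"

definition store :: "('f, 'v) schema \<Rightarrow> ('f, 'v) eqns \<Rightarrow> ('f, 'v) eqns option" where
  "store \<Theta> U = map_option fst (fin \<Theta> U)"

end

theory Submission
  imports Defs
begin

text \<open>
  Every rule preserves the set of unifiers, and Store does not change the union of store and
  active set. Hence it suffices that the final syntactic check is complete: Martelli--Montanari
  steps terminate, and an irreducible set with neither a clash nor an occurs-check failure is in
  solved form, which reads as its own unifier. Since \<open>fin\<close> selects an arbitrary outcome, one
  also has to know that an outcome exists. All equations produced by saturation relate subterms of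
  the input, so a set that is normal under the rules other than Transitivity can be properly
  enlarged by Transitivity only finitely often.
\<close>

section \<open>Terms, equations and unifiers\<close>

lemma subst_cong: "(\<And>x. x \<in> vars t \<Longrightarrow> \<sigma> x = \<tau> x) \<Longrightarrow> t \<cdot> \<sigma> = t \<cdot> \<tau>"
  by (induction t) auto

lemma subst_subst: "t \<cdot> \<tau> \<cdot> \<sigma> = t \<cdot> (\<lambda>x. \<tau> x \<cdot> \<sigma>)"
  by (induction t) auto

lemma subst_Var: "t \<cdot> Var = t"
  by (induction t) (auto simp: map_idI)

lemma vars_subst: "vars (t \<cdot> \<sigma>) = (\<Union>x \<in> vars t. vars (\<sigma> x))"
  by (induction t) auto

lemma wf_trm_subst: "wf_trm ar t \<Longrightarrow> (\<And>x. wf_trm ar (\<sigma> x)) \<Longrightarrow> wf_trm ar (t \<cdot> \<sigma>)"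
  by (induction t) auto

lemma finite_vars: "finite (vars t)"
  by (induction t) auto

lemma finite_eqns_vars: "finite E \<Longrightarrow> finite (eqns_vars E)"
  by (auto simp: eqns_vars_def finite_vars)

lemma eqns_vars_insert: "eqns_vars (insert (r, s) E) = vars r \<union> vars s \<union> eqns_vars E"
  by (auto simp: eqns_vars_def)

lemma eqns_vars_Un: "eqns_vars (E \<union> F) = eqns_vars E \<union> eqns_vars F"
  by (auto simp: eqns_vars_def)

lemma vars_subset_eqns_vars: "(r, s) \<in> E \<Longrightarrow> vars r \<union> vars s \<subseteq> eqns_vars E"
  by (auto simp: eqns_vars_def)

lemma eqns_vars_mono: "E \<subseteq> F \<Longrightarrow> eqns_vars E \<subseteq> eqns_vars F"
  by (auto simp: eqns_vars_def)

definition subst_eqns :: "('f, 'v) eqns \<Rightarrow> ('v var \<Rightarrow> ('f, 'v) trm) \<Rightarrow> ('f, 'v) eqns" where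
  "subst_eqns E \<sigma> = (\<lambda>(r, s). (r \<cdot> \<sigma>, s \<cdot> \<sigma>)) ` E"

lemma subst_eqnsI: "(r, s) \<in> E \<Longrightarrow> (r \<cdot> \<sigma>, s \<cdot> \<sigma>) \<in> subst_eqns E \<sigma>"
  unfolding subst_eqns_def by (rule rev_image_eqI) auto

lemma subst_eqns_Diff_subset:
  "subst_eqns E \<sigma> - {(r \<cdot> \<sigma>, s \<cdot> \<sigma>)} \<subseteq> subst_eqns (E - {(r, s)}) \<sigma>"
  using image_diff_subset[of "\<lambda>(r, s). (r \<cdot> \<sigma>, s \<cdot> \<sigma>)" E "{(r, s)}"]
  by (simp add: subst_eqns_def)

lemma eqns_vars_subst_eqns: "eqns_vars (subst_eqns E \<sigma>) = (\<Union>x \<in> eqns_vars E. vars (\<sigma> x))"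
  unfolding eqns_vars_def subst_eqns_def case_prod_unfold by (simp add: vars_subst)

definition unifies :: "('v var \<Rightarrow> ('f, 'v) trm) \<Rightarrow> ('f, 'v) eqns \<Rightarrow> bool" where
  "unifies \<sigma> E \<longleftrightarrow> (\<forall>(r, s) \<in> E. r \<cdot> \<sigma> = s \<cdot> \<sigma>)"

lemma unifiable_iff_unifies: "unifiable ar E \<longleftrightarrow> (\<exists>\<sigma>. is_subst ar \<sigma> \<and> unifies \<sigma> E)"
  by (simp add: unifiable_def unifies_def)

lemma unifiesD: "unifies \<sigma> E \<Longrightarrow> (r, s) \<in> E \<Longrightarrow> r \<cdot> \<sigma> = s \<cdot> \<sigma>"
  by (auto simp: unifies_def)

lemma unifies_empty: "unifies \<sigma> {}"
  by (simp add: unifies_def)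

lemma unifies_insert: "unifies \<sigma> (insert (r, s) E) \<longleftrightarrow> r \<cdot> \<sigma> = s \<cdot> \<sigma> \<and> unifies \<sigma> E"
  by (auto simp: unifies_def)

lemma unifies_Un: "unifies \<sigma> (E \<union> F) \<longleftrightarrow> unifies \<sigma> E \<and> unifies \<sigma> F"
  by (auto simp: unifies_def)

lemma unifies_zip:
  assumes "length rs = length ss"
  shows "unifies \<sigma> (set (zip rs ss)) \<longleftrightarrow> map (\<lambda>t. t \<cdot> \<sigma>) rs = map (\<lambda>t. t \<cdot> \<sigma>) ss"
  using assms by (induction rs ss rule: list_induct2) (auto simp: unifies_empty unifies_insert)

lemma unifies_subst_eqns: "unifies \<sigma> (subst_eqns E \<tau>) \<longleftrightarrow> unifies (\<lambda>x. \<tau> x \<cdot> \<sigma>) E"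
  by (simp add: unifies_def subst_eqns_def subst_subst case_prod_unfold)

definition subterm_closed :: "('f, 'v) trm set \<Rightarrow> bool" where
  "subterm_closed T \<longleftrightarrow> (\<forall>f ts. Fun f ts \<in> T \<longrightarrow> set ts \<subseteq> T)"

lemma subterm_closed_wf_trm: "subterm_closed {t. wf_trm ar t}"
  by (auto simp: subterm_closed_def)

lemma eqns_over_iff: "eqns_over ar E \<longleftrightarrow> E \<subseteq> {t. wf_trm ar t} \<times> {t. wf_trm ar t}"
  by (auto simp: eqns_over_def)

lemma eqns_over_subst_eqns:
  "eqns_over ar E \<Longrightarrow> (\<And>x. wf_trm ar (\<sigma> x)) \<Longrightarrow> eqns_over ar (subst_eqns E \<sigma>)"
  by (simp add: eqns_over_def subst_eqns_def case_prod_unfold wf_trm_subst)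

section \<open>Normal forms\<close>

lemma normal_form_exists:
  assumes "wf r" "P x" and step: "\<And>y z. P y \<Longrightarrow> R y z \<Longrightarrow> P z \<and> (z, y) \<in> r"
  obtains y where "R\<^sup>*\<^sup>* x y" "\<nexists>z. R y z" "P y"
proof -
  have invariant: "P y" if "R\<^sup>*\<^sup>* x y" for y
    using that by (induction rule: rtranclp_induct) (auto simp: \<open>P x\<close> step)
  have "wfp_on {y. R\<^sup>*\<^sup>* x y} R\<inverse>\<inverse>"
  proof (rule wfp_on_mono_strong)
    show "wfp_on UNIV (\<lambda>z y. (z, y) \<in> r)"
      using \<open>wf r\<close> by (simp add: wfp_def)
  qed (auto simp: invariant step)
  then show thesis
    using ex_terminating_rtranclp_strong invariant that by metis
qed

lemma measures_cardI:
  assumes "finite (A x)" "A y \<subset> A x \<or> A y \<subseteq> A x \<and> f y < f x"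
  shows "(y, x) \<in> measures [\<lambda>x. card (A x), f]"
  using assms psubset_card_mono[of "A x" "A y"] card_mono[of "A x" "A y"] by auto

section \<open>Rules that replace a single equation\<close>

text \<open>
  These rules are common to syntactic unification (Delete, Decompose, Swap) and to saturation
  (Reflexive, Decomposition, Orient-1).
\<close>

inductive eqn_reduct :: "('f, 'v) eqn \<Rightarrow> ('f, 'v) eqns \<Rightarrow> bool" where
  Trivial: "eqn_reduct (t, t) {}"
| Arguments: "length rs = length ss \<Longrightarrow> eqn_reduct (Fun f rs, Fun f ss) (set (zip rs ss))"
| Flip: "\<not> is_Var r \<Longrightarrow> eqn_reduct (r, Var x) {(Var x, r)}"

lemma basic_step_cases:
  assumes "basic_step U V"
  obtains (reduct) e G where "eqn_reduct e G" "e \<in> U" "V = U - {e} \<union> G"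
  | (Orient_2) x y where "(Var y, Var x) \<in> U" "(Var x, Var y) \<notin> U" "V = insert (Var x, Var y) U"
  using assms
proof cases
  case (Decomposition f rs ss)
  then show thesis
    by (intro reduct[OF eqn_reduct.Arguments])
next
  case (Orient_1 r x)
  then show thesis
    by (intro reduct[OF eqn_reduct.Flip])
next
  case (Reflexive t)
  then show thesis
    by (intro reduct[OF eqn_reduct.Trivial]) simp_all
qed (rule Orient_2)

lemma basic_step_reduct: "eqn_reduct e G \<Longrightarrow> e \<in> U \<Longrightarrow> basic_step U (U - {e} \<union> G)"
proof (induction rule: eqn_reduct.induct)
  case (Trivial t)
  then show ?case
    using basic_step.Reflexive by fastforce
next
  case (Arguments rs ss f)
  then show ?case
    by (intro basic_step.Decomposition)
next
  case (Flip r x)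
  then show ?case
    by (intro basic_step.Orient_1)
qed

definition eliminate :: "'v var \<Rightarrow> ('f, 'v) trm \<Rightarrow> ('f, 'v) eqns \<Rightarrow> ('f, 'v) eqns" where
  "eliminate x t E = insert (Var x, t) (subst_eqns (E - {(Var x, t)}) (Var(x := t)))"

lemma synt_step_cases:
  assumes "synt_step E F"
  obtains (reduct) e G where "eqn_reduct e G" "e \<in> E" "F = E - {e} \<union> G"
  | (Eliminate) x t where "(Var x, t) \<in> E" "x \<notin> vars t" "x \<in> eqns_vars (E - {(Var x, t)})"
      "F = eliminate x t E"
  using assms
proof cases
  case (Delete t)
  then show thesis
    by (intro reduct[OF eqn_reduct.Trivial]) simp_all
next
  case (Decompose f rs ss)
  then show thesis
    by (intro reduct[OF eqn_reduct.Arguments])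
next
  case (Swap r x)
  then show thesis
    by (intro reduct[OF eqn_reduct.Flip])
qed (rule Eliminate[unfolded eliminate_def subst_eqns_def])

lemma synt_step_reduct: "eqn_reduct e G \<Longrightarrow> e \<in> E \<Longrightarrow> synt_step E (E - {e} \<union> G)"
proof (induction rule: eqn_reduct.induct)
  case (Trivial t)
  then show ?case
    using synt_step.Delete by fastforce
next
  case (Arguments rs ss f)
  then show ?case
    by (intro synt_step.Decompose)
next
  case (Flip r x)
  then show ?case
    by (intro synt_step.Swap)
qed

lemma irreducible_eqn_Var_lhs:
  assumes "\<nexists>G. eqn_reduct (l, r) G" "\<not> clash {(l, r)}"
  obtains x where "l = Var x" "r \<noteq> Var x"
proof (cases l)
  case (Var x)
  then show thesis
    using assms(1) that[of x] eqn_reduct.Trivial[of l] by auto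
next
  case (Fun f rs)
  have "is_Var l"
  proof (cases r)
    case (Var y)
    then show ?thesis
      using assms(1) eqn_reduct.Flip[of l y] by auto
  next
    case (Fun g ss)
    then have "f = g" "length rs = length ss"
      using assms(2) \<open>l = Fun f rs\<close> by (auto simp: clash_def)
    then show ?thesis
      using assms(1) \<open>l = Fun f rs\<close> Fun eqn_reduct.Arguments[of rs ss f] by auto
  qed
  with Fun show thesis
    by simp
qed

lemma eqn_reduct_Var_lhs: "eqn_reduct (Var x, t) G \<Longrightarrow> t = Var x"
  by (auto elim: eqn_reduct.cases)

lemma eqn_reduct_finite: "eqn_reduct e G \<Longrightarrow> finite G"
  by (auto elim: eqn_reduct.cases)

lemma eqn_reduct_unifies: "eqn_reduct e G \<Longrightarrow> unifies \<sigma> G \<longleftrightarrow> unifies \<sigma> {e}"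
  by (induction rule: eqn_reduct.induct) (auto simp: unifies_empty unifies_insert unifies_zip)

lemma eqn_reduct_subset:
  assumes "eqn_reduct e G" "subterm_closed T" "e \<in> T \<times> T"
  shows "G \<subseteq> T \<times> T"
  using assms
  by (induction rule: eqn_reduct.induct)
    (force simp: subterm_closed_def dest: set_zip_leftD set_zip_rightD)+

lemma eqn_reduct_eqns_vars: "eqn_reduct e G \<Longrightarrow> eqns_vars G \<subseteq> eqns_vars {e}"
  by (induction rule: eqn_reduct.induct)
    (auto simp: eqns_vars_def dest: set_zip_leftD set_zip_rightD)

lemma unifies_replace_reduct:
  assumes "eqn_reduct e G" "e \<in> E"
  shows "unifies \<sigma> (E - {e} \<union> G) \<longleftrightarrow> unifies \<sigma> E"
  using eqn_reduct_unifies[OF assms(1)] unifies_Un[of \<sigma> "E - {e}" "{e}"] assms(2)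
  by (simp add: unifies_Un insert_absorb)

lemma eqns_vars_replace_reduct:
  assumes "eqn_reduct e G" "e \<in> E"
  shows "eqns_vars (E - {e} \<union> G) \<subseteq> eqns_vars E"
  using eqn_reduct_eqns_vars[OF assms(1)] eqns_vars_mono[of "{e}" E] eqns_vars_mono[of "E - {e}" E]
    assms(2) by (auto simp: eqns_vars_Un)

text \<open>The last summand makes orienting an equation decrease its weight.\<close>

fun eqn_weight :: "('f, 'v) eqn \<Rightarrow> nat" where
  "eqn_weight (r, s) = size r + size s + of_bool (\<not> is_Var r)"

definition eqns_weight :: "('f, 'v) eqns \<Rightarrow> nat" where
  "eqns_weight E = sum eqn_weight E"

lemma sum_set_le_sum_list:
  fixes f :: "'a \<Rightarrow> nat"
  shows "sum f (set xs) \<le> sum_list (map f xs)"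
  by (induction xs) (auto simp: sum.insert_if)

lemma eqns_weight_zip:
  assumes "length rs = length ss"
  shows "eqns_weight (set (zip rs ss)) < eqn_weight (Fun f rs, Fun f ss)"
proof -
  have "eqns_weight (set (zip rs ss)) \<le> sum_list (map eqn_weight (zip rs ss))"
    unfolding eqns_weight_def by (rule sum_set_le_sum_list)
  also have "\<dots> \<le> size_list size rs + size_list size ss"
    using assms by (induction rs ss rule: list_induct2) auto
  finally show ?thesis
    by simp
qed

lemma eqn_reduct_weight: "eqn_reduct e G \<Longrightarrow> eqns_weight G < eqn_weight e"
proof (induction rule: eqn_reduct.induct)
  case (Trivial t)
  show ?case
    by (cases t) (simp_all add: eqns_weight_def)
next
  case (Arguments rs ss f)
  then show ?case
    by (rule eqns_weight_zip)
qed (simp add: eqns_weight_def)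

lemma eqns_weight_replace_reduct:
  assumes "eqn_reduct e G" "e \<in> E" "finite E"
  shows "eqns_weight (E - {e} \<union> G) < eqns_weight E"
proof -
  have "eqns_weight (E - {e} \<union> G) \<le> eqns_weight (E - {e}) + eqns_weight G"
    unfolding eqns_weight_def
    using assms eqn_reduct_finite[OF assms(1)] by (simp add: sum_Un_nat)
  also have "\<dots> < eqns_weight (E - {e}) + eqn_weight e"
    using eqn_reduct_weight[OF assms(1)] by simp
  also have "\<dots> = eqns_weight E"
    unfolding eqns_weight_def using assms by (simp add: sum.remove)
  finally show ?thesis .
qed

section \<open>Completeness of syntactic unification\<close>

lemma synt_step_unifies:
  assumes "synt_step E F"
  shows "unifies \<sigma> F \<longleftrightarrow> unifies \<sigma> E"
  using assms
proof (cases rule: synt_step_cases)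
  case (reduct e G)
  then show ?thesis
    by (simp add: unifies_replace_reduct)
next
  case (Eliminate x t)
  have "(\<lambda>y. (Var(x := t)) y \<cdot> \<sigma>) = \<sigma>" if "\<sigma> x = t \<cdot> \<sigma>"
    using that by auto
  then have "unifies \<sigma> F \<longleftrightarrow> unifies \<sigma> (insert (Var x, t) (E - {(Var x, t)}))"
    unfolding Eliminate(4) eliminate_def unifies_insert unifies_subst_eqns by auto
  then show ?thesis
    using Eliminate(1) by (simp add: insert_absorb)
qed

lemma synt_steps_unifies: "synt_step\<^sup>*\<^sup>* E F \<Longrightarrow> unifies \<sigma> F \<longleftrightarrow> unifies \<sigma> E"
  by (induction rule: rtranclp_induct) (auto simp: synt_step_unifies)

lemma synt_step_eqns_over:
  assumes "synt_step E F" "eqns_over ar E"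
  shows "eqns_over ar F"
  using assms(1)
proof (cases rule: synt_step_cases)
  case (reduct e G)
  then show ?thesis
    using eqn_reduct_subset[OF reduct(1) subterm_closed_wf_trm, of ar] assms(2)
    unfolding eqns_over_iff by blast
next
  case (Eliminate x t)
  have "eqns_over ar (E - {(Var x, t)})" "wf_trm ar t"
    using assms(2) Eliminate(1) by (auto simp: eqns_over_def)
  then have "eqns_over ar (subst_eqns (E - {(Var x, t)}) (Var(x := t)))"
    by (intro eqns_over_subst_eqns) auto
  with \<open>wf_trm ar t\<close> show ?thesis
    unfolding Eliminate(4) eliminate_def by (simp add: eqns_over_def)
qed

lemma synt_steps_eqns_over: "synt_step\<^sup>*\<^sup>* E F \<Longrightarrow> eqns_over ar E \<Longrightarrow> eqns_over ar F"
  by (induction rule: rtranclp_induct) (auto intro: synt_step_eqns_over)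

lemma synt_step_finite:
  assumes "synt_step E F" "finite E"
  shows "finite F"
  using assms(1)
  by (cases rule: synt_step_cases)
    (use assms(2) in \<open>auto simp: eliminate_def subst_eqns_def eqn_reduct_finite\<close>)

definition solved_eqn :: "('f, 'v) eqns \<Rightarrow> 'v var \<Rightarrow> ('f, 'v) trm \<Rightarrow> bool" where
  "solved_eqn E x t \<longleftrightarrow> (Var x, t) \<in> E \<and> x \<notin> vars t \<and> x \<notin> eqns_vars (E - {(Var x, t)})"

definition unsolved_vars :: "('f, 'v) eqns \<Rightarrow> 'v var set" where
  "unsolved_vars E = {x \<in> eqns_vars E. \<nexists>t. solved_eqn E x t}"

definition solved_form :: "('f, 'v) eqns \<Rightarrow> bool" where
  "solved_form E \<longleftrightarrow> (\<forall>(l, r) \<in> E. \<exists>x. l = Var x \<and> solved_eqn E x r)"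

lemma solved_eqn_mem: "solved_eqn E x t \<Longrightarrow> (Var x, t) \<in> E"
  by (simp add: solved_eqn_def)

lemma solved_eqn_unique: "solved_eqn E x t \<Longrightarrow> (Var x, s) \<in> E \<Longrightarrow> s = t"
  using vars_subset_eqns_vars[of "Var x" s "E - {(Var x, t)}"] by (auto simp: solved_eqn_def)

lemma solved_eqn_notin_rhs: "solved_eqn E x t \<Longrightarrow> (l, r) \<in> E \<Longrightarrow> x \<notin> vars r"
  using vars_subset_eqns_vars[of l r "E - {(Var x, t)}"] by (auto simp: solved_eqn_def)

lemma unsolved_vars_mono:
  assumes "eqns_vars F \<subseteq> eqns_vars E" "\<And>x t. solved_eqn E x t \<Longrightarrow> \<exists>s. solved_eqn F x s"
  shows "unsolved_vars F \<subseteq> unsolved_vars E"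
  using assms by (fastforce simp: unsolved_vars_def)

lemma solved_eqn_replace_reduct:
  assumes "eqn_reduct e G" "e \<in> E" "solved_eqn E x t"
  shows "solved_eqn (E - {e} \<union> G) x t"
proof -
  have "e \<noteq> (Var x, t)"
    using assms eqn_reduct_Var_lhs by (fastforce simp: solved_eqn_def)
  then have "eqns_vars (E - {(Var x, t)} - {e} \<union> G) \<subseteq> eqns_vars (E - {(Var x, t)})"
    using assms by (intro eqns_vars_replace_reduct) auto
  moreover have "E - {e} \<union> G - {(Var x, t)} \<subseteq> E - {(Var x, t)} - {e} \<union> G"
    by blast
  ultimately have "eqns_vars (E - {e} \<union> G - {(Var x, t)}) \<subseteq> eqns_vars (E - {(Var x, t)})"
    using eqns_vars_mono by blast
  then show ?thesis
    using assms(3) \<open>e \<noteq> (Var x, t)\<close> by (auto simp: solved_eqn_def)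
qed

lemma eqns_vars_subst_eqns_single:
  "eqns_vars (subst_eqns E (Var(x := t))) \<subseteq> (eqns_vars E - {x}) \<union> vars t"
  by (auto simp: eqns_vars_subst_eqns split: if_splits)

lemma eqns_vars_eliminate:
  assumes "(Var x, t) \<in> E"
  shows "eqns_vars (eliminate x t E) \<subseteq> eqns_vars E"
  unfolding eliminate_def eqns_vars_insert
  using eqns_vars_subst_eqns_single[of "E - {(Var x, t)}" x t] vars_subset_eqns_vars[OF assms]
    eqns_vars_mono[of "E - {(Var x, t)}" E] by auto

lemma solved_eqn_eliminate_other:
  assumes "(Var x, t) \<in> E" "x \<in> eqns_vars (E - {(Var x, t)})" "solved_eqn E y s"
  shows "solved_eqn (eliminate x t E) y (s \<cdot> Var(x := t))"
proof -
  let ?\<tau> = "Var(x := t)" and ?rest = "E - {(Var x, t)} - {(Var y, s)}"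
  have "y \<noteq> x"
  proof
    assume "y = x"
    then have "t = s"
      using assms(1,3) solved_eqn_unique by fast
    then show False
      using assms(2,3) \<open>y = x\<close> by (simp add: solved_eqn_def)
  qed
  have "y \<notin> vars t"
    using assms(3,1) by (rule solved_eqn_notin_rhs)
  have "y \<notin> vars s"
    using assms(3) by (simp add: solved_eqn_def)
  have "(Var y, s) \<in> E - {(Var x, t)}"
    using solved_eqn_mem[OF assms(3)] \<open>y \<noteq> x\<close> by simp
  then have "(Var y, s \<cdot> ?\<tau>) \<in> eliminate x t E"
    using subst_eqnsI[of "Var y" s _ ?\<tau>] \<open>y \<noteq> x\<close> by (simp add: eliminate_def)
  moreover have "y \<notin> vars (s \<cdot> ?\<tau>)"
    using \<open>y \<notin> vars s\<close> \<open>y \<notin> vars t\<close> by (auto simp: vars_subst split: if_splits)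
  moreover have "y \<notin> eqns_vars ?rest"
    using assms(3) eqns_vars_mono[of ?rest "E - {(Var y, s)}"] by (auto simp: solved_eqn_def)
  then have "y \<notin> eqns_vars (insert (Var x, t) (subst_eqns ?rest ?\<tau>))"
    using eqns_vars_subst_eqns_single[of ?rest x t] \<open>y \<noteq> x\<close> \<open>y \<notin> vars t\<close>
    by (auto simp: eqns_vars_insert)
  moreover have "eliminate x t E - {(Var y, s \<cdot> ?\<tau>)} \<subseteq> insert (Var x, t) (subst_eqns ?rest ?\<tau>)"
    using subst_eqns_Diff_subset[of "E - {(Var x, t)}" ?\<tau> "Var y" s] \<open>y \<noteq> x\<close>
    by (auto simp: eliminate_def)
  then have "eqns_vars (eliminate x t E - {(Var y, s \<cdot> ?\<tau>)}) \<subseteq>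
      eqns_vars (insert (Var x, t) (subst_eqns ?rest ?\<tau>))"
    by (rule eqns_vars_mono)
  ultimately show ?thesis
    by (auto simp only: solved_eqn_def)
qed

lemma solved_eqn_eliminate:
  assumes "x \<notin> vars t"
  shows "solved_eqn (eliminate x t E) x t"
proof -
  have "eqns_vars (eliminate x t E - {(Var x, t)}) \<subseteq>
      eqns_vars (subst_eqns (E - {(Var x, t)}) (Var(x := t)))"
    by (rule eqns_vars_mono) (auto simp: eliminate_def)
  then show ?thesis
    using assms eqns_vars_subst_eqns_single[of "E - {(Var x, t)}" x t]
    by (auto simp: solved_eqn_def eliminate_def)
qed

lemma unsolved_vars_eliminate:
  assumes "(Var x, t) \<in> E" "x \<notin> vars t" "x \<in> eqns_vars (E - {(Var x, t)})"
  shows "unsolved_vars (eliminate x t E) \<subset> unsolved_vars E"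
proof
  show "unsolved_vars (eliminate x t E) \<subseteq> unsolved_vars E"
    by (rule unsolved_vars_mono)
      (use assms in \<open>blast intro: eqns_vars_eliminate[THEN subsetD] solved_eqn_eliminate_other\<close>)+
  have "x \<in> eqns_vars E"
    using assms(3) eqns_vars_mono[of "E - {(Var x, t)}" E] by auto
  moreover have "\<not> solved_eqn E x s" for s
    using assms(1,3) solved_eqn_unique[of E x s t] by (auto simp: solved_eqn_def)
  ultimately have "x \<in> unsolved_vars E"
    by (simp add: unsolved_vars_def)
  moreover have "x \<notin> unsolved_vars (eliminate x t E)"
    using solved_eqn_eliminate[OF assms(2), of E] by (auto simp: unsolved_vars_def)
  ultimately show "unsolved_vars (eliminate x t E) \<noteq> unsolved_vars E"
    by blast
qed

lemma synt_step_decreases: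
  assumes "synt_step E F" "finite E"
  shows "(F, E) \<in> measures [\<lambda>E. card (unsolved_vars E), eqns_weight]"
proof (rule measures_cardI)
  show "finite (unsolved_vars E)"
    using assms(2) by (simp add: unsolved_vars_def finite_eqns_vars)
  show "unsolved_vars F \<subset> unsolved_vars E \<or>
      unsolved_vars F \<subseteq> unsolved_vars E \<and> eqns_weight F < eqns_weight E"
    using assms(1)
  proof (cases rule: synt_step_cases)
    case (reduct e G)
    have "unsolved_vars F \<subseteq> unsolved_vars E"
      unfolding reduct(3)
      by (rule unsolved_vars_mono)
        (use reduct(1,2) in \<open>auto intro: eqns_vars_replace_reduct[THEN subsetD]
          solved_eqn_replace_reduct\<close>)
    moreover have "eqns_weight F < eqns_weight E"
      unfolding reduct(3) using reduct(1,2) assms(2) by (rule eqns_weight_replace_reduct)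
    ultimately show ?thesis
      by blast
  next
    case (Eliminate x t)
    then show ?thesis
      using unsolved_vars_eliminate by blast
  qed
qed

lemma synt_normal_form_exists:
  assumes "finite E"
  obtains F where "synt_step\<^sup>*\<^sup>* E F" "\<nexists>G. synt_step F G" "finite F"
  by (rule normal_form_exists[where P = finite and R = synt_step, OF wf_measures assms])
    (blast intro: synt_step_finite synt_step_decreases)+

lemma synt_normal_solved_form:
  assumes "\<nexists>F. synt_step E F" "\<not> clash E" "\<not> occurs_check E"
  shows "solved_form E"
  unfolding solved_form_def
proof clarify
  fix l r assume "(l, r) \<in> E"
  have "\<nexists>G. eqn_reduct (l, r) G"
    using \<open>(l, r) \<in> E\<close> assms(1) synt_step_reduct by blast
  moreover have "\<not> clash {(l, r)}"
    using \<open>(l, r) \<in> E\<close> assms(2) by (auto simp: clash_def)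
  ultimately obtain x where "l = Var x" "r \<noteq> Var x"
    by (rule irreducible_eqn_Var_lhs)
  have "(Var x, r) \<in> E"
    using \<open>(l, r) \<in> E\<close> \<open>l = Var x\<close> by simp
  then have "x \<notin> vars r"
    using \<open>r \<noteq> Var x\<close> assms(3) unfolding occurs_check_def by blast
  moreover from this have "x \<notin> eqns_vars (E - {(Var x, r)})"
    using \<open>(Var x, r) \<in> E\<close> assms(1) synt_step.Eliminate by blast
  ultimately show "\<exists>x. l = Var x \<and> solved_eqn E x r"
    using \<open>(Var x, r) \<in> E\<close> \<open>l = Var x\<close> by (simp add: solved_eqn_def)
qed

definition solved_subst :: "('f, 'v) eqns \<Rightarrow> 'v var \<Rightarrow> ('f, 'v) trm" where
  "solved_subst E x = (if \<exists>t. solved_eqn E x t then THE t. solved_eqn E x t else Var x)"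

lemma solved_subst_solved:
  assumes "solved_eqn E x t"
  shows "solved_subst E x = t"
proof -
  have "(THE t. solved_eqn E x t) = t"
  proof (rule the_equality)
    show "solved_eqn E x t"
      by (fact assms)
    show "s = t" if "solved_eqn E x s" for s
      using assms solved_eqn_mem[OF that] by (rule solved_eqn_unique)
  qed
  then show ?thesis
    using assms by (auto simp: solved_subst_def)
qed

lemma solved_subst_unsolved: "\<nexists>t. solved_eqn E x t \<Longrightarrow> solved_subst E x = Var x"
  by (simp add: solved_subst_def)

lemma is_subst_solved_subst:
  assumes "finite E" "eqns_over ar E"
  shows "is_subst ar (solved_subst E)"
  unfolding is_subst_def
proof
  have "x \<in> eqns_vars E" if "solved_subst E x \<noteq> Var x" for x
  proof -
    obtain t where "solved_eqn E x t"
      using \<open>solved_subst E x \<noteq> Var x\<close> solved_subst_unsolved by blast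
    then show ?thesis
      using vars_subset_eqns_vars[of "Var x" t E] by (simp add: solved_eqn_mem)
  qed
  then have "{x. solved_subst E x \<noteq> Var x} \<subseteq> eqns_vars E"
    by blast
  then show "finite {x. solved_subst E x \<noteq> Var x}"
    using finite_eqns_vars[OF assms(1)] by (rule finite_subset)
  have "wf_trm ar (solved_subst E x)" for x
  proof (cases "\<exists>t. solved_eqn E x t")
    case True
    then obtain t where solved: "solved_eqn E x t" ..
    then have "wf_trm ar t"
      using assms(2) solved_eqn_mem unfolding eqns_over_def by blast
    then show ?thesis
      by (simp add: solved_subst_solved[OF solved])
  qed (simp add: solved_subst_unsolved)
  then show "\<forall>x. wf_trm ar (solved_subst E x)" ..
qed

lemma unifies_solved_subst:
  assumes "solved_form E"
  shows "unifies (solved_subst E) E"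
  unfolding unifies_def
proof clarify
  fix l r assume "(l, r) \<in> E"
  then obtain x where "l = Var x" "solved_eqn E x r"
    using assms by (auto simp: solved_form_def)
  have "solved_subst E y = Var y" if "y \<in> vars r" for y
    using that \<open>(l, r) \<in> E\<close> solved_eqn_notin_rhs solved_subst_unsolved by metis
  then have "r \<cdot> solved_subst E = r \<cdot> Var"
    by (rule subst_cong)
  then show "l \<cdot> solved_subst E = r \<cdot> solved_subst E"
    using \<open>l = Var x\<close> \<open>solved_eqn E x r\<close> by (simp add: solved_subst_solved subst_Var)
qed

theorem synt_unif_complete:
  assumes "finite E" "eqns_over ar E" "\<not> synt_unif_fails E"
  shows "unifiable ar E"
proof -
  obtain F where steps: "synt_step\<^sup>*\<^sup>* E F" and normal: "\<nexists>G. synt_step F G" and "finite F"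
    using assms(1) by (rule synt_normal_form_exists)
  have "\<not> clash F" "\<not> occurs_check F"
    using assms(3) steps by (auto simp: synt_unif_fails_def)
  with normal have "unifies (solved_subst F) F"
    by (intro unifies_solved_subst synt_normal_solved_form)
  then have "unifies (solved_subst F) E"
    by (simp add: synt_steps_unifies[OF steps])
  moreover have "is_subst ar (solved_subst F)"
    using \<open>finite F\<close> synt_steps_eqns_over[OF steps assms(2)] by (rule is_subst_solved_subst)
  ultimately show ?thesis
    by (auto simp: unifiable_iff_unifies)
qed

section \<open>Saturation\<close>

lemma sat_step_cases:
  assumes "sat_step U V"
  obtains (reduct) e G where "eqn_reduct e G" "e \<in> U" "V = U - {e} \<union> G"
  | (Orient_2) x y where "(Var y, Var x) \<in> U" "V = insert (Var x, Var y) U"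
  | (Transitivity) x r s where "(Var x, r) \<in> U" "(Var x, s) \<in> U" "V = insert (r, s) U"
  using assms unfolding sat_step_def by (auto elim: basic_step_cases trans_step.cases)

lemma sat_step_unifies:
  assumes "sat_step U V"
  shows "unifies \<sigma> V \<longleftrightarrow> unifies \<sigma> U"
  using assms
proof (cases rule: sat_step_cases)
  case (reduct e G)
  then show ?thesis
    by (simp add: unifies_replace_reduct)
next
  case (Orient_2 x y)
  then show ?thesis
    using unifiesD by (fastforce simp: unifies_insert)
next
  case (Transitivity x r s)
  then show ?thesis
    using unifiesD by (metis unifies_insert)
qed

lemma sat_steps_unifies: "sat_step\<^sup>*\<^sup>* U V \<Longrightarrow> unifies \<sigma> V \<longleftrightarrow> unifies \<sigma> U"
  by (induction rule: rtranclp_induct) (auto simp: sat_step_unifies)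

lemma sat_step_subset:
  assumes "sat_step U V" "subterm_closed T" "U \<subseteq> T \<times> T"
  shows "V \<subseteq> T \<times> T"
  using assms(1)
proof (cases rule: sat_step_cases)
  case (reduct e G)
  then show ?thesis
    using eqn_reduct_subset assms(2,3) by blast
qed (use assms(3) in auto)

lemma sat_steps_subset:
  "sat_step\<^sup>*\<^sup>* U V \<Longrightarrow> subterm_closed T \<Longrightarrow> U \<subseteq> T \<times> T \<Longrightarrow> V \<subseteq> T \<times> T"
  by (induction rule: rtranclp_induct) (auto dest: sat_step_subset)

lemma sat_steps_eqns_over: "sat_step\<^sup>*\<^sup>* U V \<Longrightarrow> eqns_over ar U \<Longrightarrow> eqns_over ar V"
  unfolding eqns_over_iff by (rule sat_steps_subset[OF _ subterm_closed_wf_trm])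

fun subterms :: "('f, 'v) trm \<Rightarrow> ('f, 'v) trm set" where
  "subterms (Var x) = {Var x}"
| "subterms (Fun f ts) = insert (Fun f ts) (\<Union>t \<in> set ts. subterms t)"

lemma subterms_refl: "t \<in> subterms t"
  by (cases t) auto

lemma finite_subterms: "finite (subterms t)"
  by (induction t) auto

lemma subterm_closed_Union: "(\<And>T. T \<in> \<T> \<Longrightarrow> subterm_closed T) \<Longrightarrow> subterm_closed (\<Union>\<T>)"
  unfolding subterm_closed_def by blast

lemma subterm_closed_insert:
  "subterm_closed T \<Longrightarrow> set ts \<subseteq> T \<Longrightarrow> subterm_closed (insert (Fun f ts) T)"
  by (auto simp: subterm_closed_def)

lemma subterm_closed_subterms: "subterm_closed (subterms t)"
proof (induction t)
  case (Fun f ts)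
  have "subterm_closed (\<Union>t \<in> set ts. subterms t)"
    using Fun.IH by (intro subterm_closed_Union) auto
  then show ?case
    using subterms_refl by (auto intro: subterm_closed_insert)
qed (simp add: subterm_closed_def)

lemma finite_subterm_closed_cover:
  assumes "finite U"
  obtains T where "finite T" "subterm_closed T" "U \<subseteq> T \<times> T"
proof
  let ?T = "\<Union>(subterms ` (fst ` U \<union> snd ` U))"
  show "finite ?T"
    using assms by (auto simp: finite_subterms)
  show "subterm_closed ?T"
    by (rule subterm_closed_Union) (auto simp: subterm_closed_subterms)
  show "U \<subseteq> ?T \<times> ?T"
    using subterms_refl by fastforce
qed

lemma sat_steps_finite:
  assumes "sat_step\<^sup>*\<^sup>* U V" "finite U"
  shows "finite V"
proof -
  obtain T where "finite T" "subterm_closed T" "U \<subseteq> T \<times> T"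
    using assms(2) by (rule finite_subterm_closed_cover)
  then show ?thesis
    using sat_steps_subset[OF assms(1)] finite_subset by blast
qed

lemma basic_steps_sat_steps: "basic_step\<^sup>*\<^sup>* U V \<Longrightarrow> sat_step\<^sup>*\<^sup>* U V"
  by (erule mono_rtranclp[rule_format, rotated]) (simp add: sat_step_def)

definition missing_var_eqns :: "('f, 'v) eqns \<Rightarrow> ('v var \<times> 'v var) set" where
  "missing_var_eqns U =
    {(x, y) \<in> eqns_vars U \<times> eqns_vars U. x \<noteq> y \<and> (Var x, Var y) \<notin> U}"

text \<open>
  Orient-2 raises the weight, but it adds an equation between distinct variables, and such
  equations are never removed.
\<close>

lemma basic_step_decreases:
  assumes "basic_step U V" "finite U"
  shows "(V, U) \<in> measures [\<lambda>U. card (missing_var_eqns U), eqns_weight]"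
proof (rule measures_cardI)
  show "finite (missing_var_eqns U)"
    by (rule finite_subset[of _ "eqns_vars U \<times> eqns_vars U"])
      (auto simp: missing_var_eqns_def finite_eqns_vars[OF assms(2)])
  show "missing_var_eqns V \<subset> missing_var_eqns U \<or>
      missing_var_eqns V \<subseteq> missing_var_eqns U \<and> eqns_weight V < eqns_weight U"
    using assms(1)
  proof (cases rule: basic_step_cases)
    case (reduct e G)
    then have "eqns_vars V \<subseteq> eqns_vars U"
      by (simp add: eqns_vars_replace_reduct)
    moreover have "(Var x, Var y) \<in> V" if "(Var x, Var y) \<in> U" "x \<noteq> y" for x y
      using that reduct eqn_reduct_Var_lhs by blast
    ultimately have "missing_var_eqns V \<subseteq> missing_var_eqns U"
      unfolding missing_var_eqns_def by blast
    moreover have "eqns_weight V < eqns_weight U"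
      unfolding reduct(3) using reduct(1,2) assms(2) by (rule eqns_weight_replace_reduct)
    ultimately show ?thesis
      by blast
  next
    case (Orient_2 x y)
    then have "x \<in> eqns_vars U" "y \<in> eqns_vars U"
      using vars_subset_eqns_vars[OF Orient_2(1)] by auto
    then have "eqns_vars V = eqns_vars U"
      by (auto simp: Orient_2(3) eqns_vars_insert)
    then have "missing_var_eqns V = missing_var_eqns U - {(x, y)}"
      by (auto simp: missing_var_eqns_def Orient_2(3))
    moreover have "(x, y) \<in> missing_var_eqns U"
      using Orient_2(1,2) \<open>x \<in> eqns_vars U\<close> \<open>y \<in> eqns_vars U\<close>
      by (auto simp: missing_var_eqns_def)
    ultimately show ?thesis
      by blast
  qed
qed

lemma basic_normal_form_exists:
  assumes "finite U"
  obtains V where "basic_step\<^sup>*\<^sup>* U V" "\<nexists>W. basic_step V W"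
proof (rule normal_form_exists[where P = finite and R = basic_step, OF wf_measures assms])
  fix V W :: "('a, 'b) eqns"
  assume "finite V" "basic_step V W"
  then show "finite W \<and> (W, V) \<in> measures [\<lambda>U. card (missing_var_eqns U), eqns_weight]"
    using basic_step_decreases basic_steps_sat_steps sat_steps_finite by blast
qed

lemma basic_step_keeps_irreducible:
  assumes "basic_step V W" "e \<in> V" "\<nexists>G. eqn_reduct e G"
  shows "e \<in> W"
  using assms(1) by (cases rule: basic_step_cases) (use assms(2,3) in blast)+

lemma basic_steps_keep_normal:
  assumes "basic_step\<^sup>*\<^sup>* V W" "U \<subseteq> V" "\<nexists>X. basic_step U X"
  shows "U \<subseteq> W"
proof -
  have "\<nexists>G. eqn_reduct e G" if "e \<in> U" for e
    using that assms(3) basic_step_reduct by blast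
  with assms(1,2) show ?thesis
    by (induction rule: rtranclp_induct) (blast intro: basic_step_keeps_irreducible)+
qed

definition saturation_round :: "('f, 'v) eqns \<Rightarrow> ('f, 'v) eqns \<Rightarrow> bool" where
  "saturation_round U W \<longleftrightarrow>
    (\<exists>V. trans_step U V \<and> \<not> basic_step\<^sup>*\<^sup>* V U \<and> basic_step\<^sup>*\<^sup>* V W) \<and> (\<nexists>X. basic_step W X)"

lemma saturation_round_sat_steps: "saturation_round U W \<Longrightarrow> sat_step\<^sup>*\<^sup>* U W"
  unfolding saturation_round_def
  by (meson basic_steps_sat_steps converse_rtranclp_into_rtranclp sat_step_def)

lemma saturation_round_psubset:
  assumes "saturation_round U W" "\<nexists>X. basic_step U X"
  shows "U \<subset> W"
proof -
  obtain V where "trans_step U V" and no_return: "\<not> basic_step\<^sup>*\<^sup>* V U"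
    and steps: "basic_step\<^sup>*\<^sup>* V W"
    using assms(1) by (auto simp: saturation_round_def)
  from \<open>trans_step U V\<close> have "U \<subseteq> V"
    by cases auto
  with steps have "U \<subseteq> W"
    using assms(2) by (rule basic_steps_keep_normal)
  moreover have "U \<noteq> W"
    using steps no_return by blast
  ultimately show ?thesis
    by blast
qed

lemma saturated_if_no_round:
  assumes "finite U" "\<nexists>V. basic_step U V" "\<not> clash U" "\<nexists>W. saturation_round U W"
  shows "saturated U"
proof -
  have "basic_step\<^sup>*\<^sup>* V U" if "trans_step U V" for V
  proof -
    have "finite V"
      using that assms(1) by cases auto
    then obtain W where "basic_step\<^sup>*\<^sup>* V W" "\<nexists>X. basic_step W X"
      by (rule basic_normal_form_exists)
    then show ?thesis
      using assms(4) that unfolding saturation_round_def by blast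
  qed
  then show ?thesis
    using assms(2,3) by (simp add: saturated_def)
qed

lemma saturation_round_decreases:
  assumes "saturation_round U W" "\<nexists>X. basic_step U X"
    and "finite T" "subterm_closed T" "U \<subseteq> T \<times> T"
  shows "W \<subseteq> T \<times> T" "(W, U) \<in> measure (\<lambda>U. card (T \<times> T - U))"
proof -
  show "W \<subseteq> T \<times> T"
    using saturation_round_sat_steps[OF assms(1)] assms(4,5) by (rule sat_steps_subset)
  moreover have "U \<subset> W"
    using assms(1,2) by (rule saturation_round_psubset)
  ultimately have "card (T \<times> T - W) < card (T \<times> T - U)"
    using assms(3) by (intro psubset_card_mono) auto
  then show "(W, U) \<in> measure (\<lambda>U. card (T \<times> T - U))"
    by simp
qed

lemma saturation_rounds_sat_steps: "saturation_round\<^sup>*\<^sup>* U W \<Longrightarrow> sat_step\<^sup>*\<^sup>* U W"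
  by (induction rule: rtranclp_induct)
    (auto dest: saturation_round_sat_steps intro: rtranclp_trans)

lemma clash_or_saturated_exists:
  assumes "finite U"
  obtains V where "sat_step\<^sup>*\<^sup>* U V" "clash V \<or> saturated V"
proof -
  obtain T where "finite T" "subterm_closed T" "U \<subseteq> T \<times> T"
    using assms by (rule finite_subterm_closed_cover)
  define normal_over where
    "normal_over V \<longleftrightarrow> V \<subseteq> T \<times> T \<and> (\<nexists>X. basic_step V X)" for V
  obtain V where "sat_step\<^sup>*\<^sup>* U V" "\<nexists>X. basic_step V X"
    using assms basic_normal_form_exists basic_steps_sat_steps by metis
  then have "normal_over V"
    using \<open>subterm_closed T\<close> \<open>U \<subseteq> T \<times> T\<close> sat_steps_subset unfolding normal_over_def by blast
  moreover have "normal_over Y \<and> (Y, X) \<in> measure (\<lambda>X. card (T \<times> T - X))"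
    if "normal_over X" "saturation_round X Y" for X Y
    using that saturation_round_decreases[of X Y T] \<open>finite T\<close> \<open>subterm_closed T\<close>
    by (simp add: normal_over_def saturation_round_def)
  ultimately obtain W where "saturation_round\<^sup>*\<^sup>* V W" "\<nexists>X. saturation_round W X" "normal_over W"
    by (rule normal_form_exists[OF wf_measure])
  moreover from this have "finite W"
    using \<open>finite T\<close> finite_subset unfolding normal_over_def by blast
  ultimately have "clash W \<or> saturated W"
    using saturated_if_no_round unfolding normal_over_def by blast
  moreover have "sat_step\<^sup>*\<^sup>* U W"
    using \<open>sat_step\<^sup>*\<^sup>* U V\<close> saturation_rounds_sat_steps[OF \<open>saturation_round\<^sup>*\<^sup>* V W\<close>]
    by (rule rtranclp_trans)
  ultimately show thesis
    using that by blast
qed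

section \<open>Outcomes\<close>

lemma store_normal_form_exists:
  assumes "finite A"
  obtains S' A' where
    "(store_step \<Theta>)\<^sup>*\<^sup>* (S, A) (S', A')" "\<nexists>C. store_step \<Theta> (S', A') C"
proof (rule normal_form_exists[where P = "\<lambda>C. finite (snd C)" and R = "store_step \<Theta>"])
  show "finite (snd (S, A))"
    using assms by simp
next
  fix C D assume "finite (snd C)" "store_step \<Theta> C D"
  from this(2,1) show "finite (snd D) \<and> (D, C) \<in> measure (\<lambda>C. card (snd C))"
    by cases (auto simp: card_gt_0_iff intro!: diff_less)
next
  fix C assume "(store_step \<Theta>)\<^sup>*\<^sup>* (S, A) C" "\<nexists>D. store_step \<Theta> C D"
  then show thesis
    using that by (cases C) blast
qed (rule wf_measure)

lemma theta_outcome_exists: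
  assumes "finite U"
  shows "\<exists>C. theta_outcome \<Theta> U C"
proof -
  obtain V where steps: "sat_step\<^sup>*\<^sup>* U V" and "clash V \<or> saturated V"
    using assms by (rule clash_or_saturated_exists)
  from \<open>clash V \<or> saturated V\<close> show ?thesis
  proof
    assume "clash V"
    with steps show ?thesis
      using theta_outcome.Clash by blast
  next
    assume "saturated V"
    have "finite V"
      using steps assms by (rule sat_steps_finite)
    then obtain S A where
      "(store_step \<Theta>)\<^sup>*\<^sup>* ({}, V) (S, A)" "\<nexists>C. store_step \<Theta> (S, A) C"
      by (rule store_normal_form_exists)
    with steps \<open>saturated V\<close> show ?thesis
      using theta_outcome.Synt_fail theta_outcome.Success by metis
  qed
qed

lemma theta_outcome_fin: "finite U \<Longrightarrow> theta_outcome \<Theta> U (fin \<Theta> U)"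
  unfolding fin_def by (rule someI_ex) (rule theta_outcome_exists)

lemma store_step_union: "store_step \<Theta> C D \<Longrightarrow> fst D \<union> snd D = fst C \<union> snd C"
  by (induction rule: store_step.induct) auto

lemma store_steps_union: "(store_step \<Theta>)\<^sup>*\<^sup>* C D \<Longrightarrow> fst D \<union> snd D = fst C \<union> snd C"
  by (induction rule: rtranclp_induct) (simp_all add: store_step_union)

lemma theta_outcome_unifiable:
  assumes "theta_outcome \<Theta> U (Some (S, A))" "finite U" "eqns_over ar U"
  shows "unifiable ar U"
proof -
  obtain V where steps: "sat_step\<^sup>*\<^sup>* U V" and "(store_step \<Theta>)\<^sup>*\<^sup>* ({}, V) (S, A)"
    and no_failure: "\<not> synt_unif_fails (S \<union> A)"
    using assms(1) by (auto elim: theta_outcome.cases)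
  then have "S \<union> A = V"
    using store_steps_union by fastforce
  then have "unifiable ar V"
    using no_failure sat_steps_finite[OF steps assms(2)] sat_steps_eqns_over[OF steps assms(3)]
    by (auto intro: synt_unif_complete)
  then show ?thesis
    by (simp add: unifiable_iff_unifies sat_steps_unifies[OF steps])
qed

theorem theorem4:
  fixes ar :: "'f \<Rightarrow> nat"
    and \<Theta> :: "('f, 'v :: {countable, infinite}) schema"
    and U :: "('f, 'v) eqns"
  assumes "subst_schema ar \<Theta>"
    and "finite U"
    and "eqns_over ar U"
    and "store \<Theta> U \<noteq> None"
  shows "unifiable ar U"
proof -
  obtain S A where "fin \<Theta> U = Some (S, A)"
    using assms(4) by (auto simp: store_def)
  then have "theta_outcome \<Theta> U (Some (S, A))"
    using theta_outcome_fin[OF assms(2), of \<Theta>] by simp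
  then show ?thesis
    using assms(2,3) by (rule theta_outcome_unifiable)
qed

end
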